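(* Let $A$ be a unital C*-algebra and let $\alpha\colon G\to \mathrm{Aut}(A)$ be an action of a finite group $G$ on $A$. Then $\alpha$ has the standard (unital) Rokhlin property if and only if it has the Rokhlin property (defined via positive contractions).
   Context: No separability is assumed. Standard (unital) Rokhlin property: for every finite set $F\subset A$ and every $\epsilon>0$ there are mutually orthogonal projections $(p_g)_{g\in G}\subset A$ such that $\|\alpha_g(p_h)-p_{gh}\|<\epsilon$ for all $g,h\in G$; $\|p_ga-ap_g\|<\epsilon$ for all $g\in G$, $a\in F$; and $\sum_{g\in G}p_g=1_A$. Rokhlin property (defined via positive contractions): for any $\epsilon>0$ and any finite subset $F\subset A$ there exist mutually orthogonal positive contractions $(r_g)_{g\in G}\subset A$ such that (i) $\|\alpha_g(r_h)-r_{gh}\|<\epsilon$ for all $g,h\in G$; (ii) $\|r_ga-ar_g\|<\epsilon$ for all $a\in F$ and $g\in G$; (iii) $\|(\sum_{g\in G} r_g)a-a\|<\epsilon$ for all $a\in F$. *)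

theory Defs
  imports Complex_Main "HOL-Algebra.Group"
begin

text \<open>
  Unital C*-algebras as a type class. The unit comes from \<open>monoid_mult\<close> rather than from
  \<open>real_normed_algebra_1\<close>, because the latter demands \<open>0 \<noteq> 1\<close> and would exclude the zero algebra.
  The real scalar multiplication inherited from the library is tied to the complex one by
  \<open>scaleR_eq_scaleC\<close>.
\<close>

class unital_cstar_algebra = real_normed_algebra + banach + monoid_mult +
  fixes scaleC :: "complex \<Rightarrow> 'a \<Rightarrow> 'a"  (infixr "*\<^sub>C" 75)
    and star :: "'a \<Rightarrow> 'a"
  assumes scaleC_add_right: "c *\<^sub>C (x + y) = c *\<^sub>C x + c *\<^sub>C y"
    and scaleC_add_left: "(c + d) *\<^sub>C x = c *\<^sub>C x + d *\<^sub>C x"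
    and scaleC_scaleC: "c *\<^sub>C d *\<^sub>C x = (c * d) *\<^sub>C x"
    and scaleC_one: "1 *\<^sub>C x = x"
    and scaleR_eq_scaleC: "r *\<^sub>R x = complex_of_real r *\<^sub>C x"
    and mult_scaleC_left: "(c *\<^sub>C x) * y = c *\<^sub>C (x * y)"
    and mult_scaleC_right: "x * (c *\<^sub>C y) = c *\<^sub>C (x * y)"
    and norm_scaleC: "norm (c *\<^sub>C x) = cmod c * norm x"
    and star_add: "star (x + y) = star x + star y"
    and star_scaleC: "star (c *\<^sub>C x) = cnj c *\<^sub>C star x"
    and star_mult: "star (x * y) = star y * star x"
    and star_star: "star (star x) = x"
    and cstar_identity: "norm (star x * x) = (norm x)\<^sup>2"

definition spectrum :: "'a::unital_cstar_algebra \<Rightarrow> complex set" where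
  "spectrum a = {c. \<not> (\<exists>b. (a - c *\<^sub>C 1) * b = 1 \<and> b * (a - c *\<^sub>C 1) = 1)}"

definition positive :: "'a::unital_cstar_algebra \<Rightarrow> bool" where
  "positive a \<longleftrightarrow> star a = a \<and> spectrum a \<subseteq> {complex_of_real t |t. 0 \<le> t}"

definition positive_contraction :: "'a::unital_cstar_algebra \<Rightarrow> bool" where
  "positive_contraction a \<longleftrightarrow> positive a \<and> norm a \<le> 1"

definition projection :: "'a::unital_cstar_algebra \<Rightarrow> bool" where
  "projection p \<longleftrightarrow> star p = p \<and> p * p = p"

definition star_automorphism :: "('a::unital_cstar_algebra \<Rightarrow> 'a) \<Rightarrow> bool" where
  "star_automorphism f \<longleftrightarrow> bij f
     \<and> (\<forall>x y. f (x + y) = f x + f y)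
     \<and> (\<forall>c x. f (c *\<^sub>C x) = c *\<^sub>C f x)
     \<and> (\<forall>x y. f (x * y) = f x * f y)
     \<and> (\<forall>x. f (star x) = star (f x))"

definition Aut :: "('a::unital_cstar_algebra \<Rightarrow> 'a) monoid" where
  "Aut = \<lparr>carrier = {f. star_automorphism f}, mult = (\<circ>), one = id\<rparr>"

lemma star_automorphism_inv:
  fixes f :: "'a::unital_cstar_algebra \<Rightarrow> 'a"
  assumes "star_automorphism f"
  shows "star_automorphism (inv_into UNIV f)"
proof -
  have f: "bij f" using assms by (simp add: star_automorphism_def)
  then have *: "inv_into UNIV f z = w \<longleftrightarrow> z = f w" for z w
    by (metis bij_inv_eq_iff)
  have r: "f (inv_into UNIV f z) = z" for z
    using f by (simp add: bij_is_surj surj_f_inv_f)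
  show ?thesis
    using assms by (simp add: star_automorphism_def bij_imp_bij_inv * r)
qed

lemma group_Aut: "group (Aut :: ('a::unital_cstar_algebra \<Rightarrow> 'a) monoid)"
proof (rule groupI)
  fix f :: "'a \<Rightarrow> 'a"
  assume "f \<in> carrier Aut"
  then have f: "star_automorphism f" by (simp add: Aut_def)
  then have "inv_into UNIV f \<circ> f = id" by (simp add: star_automorphism_def bij_is_inj)
  with star_automorphism_inv[OF f]
  show "\<exists>g\<in>carrier Aut. g \<otimes>\<^bsub>Aut\<^esub> f = \<one>\<^bsub>Aut\<^esub>" by (auto simp: Aut_def)
qed (auto simp: Aut_def star_automorphism_def bij_comp)

definition orthogonal_family :: "'i set \<Rightarrow> ('i \<Rightarrow> 'a::unital_cstar_algebra) \<Rightarrow> bool" where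
  "orthogonal_family I p \<longleftrightarrow> (\<forall>g\<in>I. \<forall>h\<in>I. g \<noteq> h \<longrightarrow> p g * p h = 0)"

definition unital_rokhlin_property ::
    "('g, 'm) monoid_scheme \<Rightarrow> ('g \<Rightarrow> 'a::unital_cstar_algebra \<Rightarrow> 'a) \<Rightarrow> bool" where
  "unital_rokhlin_property G \<alpha> \<longleftrightarrow>
     (\<forall>F :: 'a set. \<forall>\<epsilon>::real. finite F \<longrightarrow> \<epsilon> > 0 \<longrightarrow>
       (\<exists>p :: 'g \<Rightarrow> 'a.
          (\<forall>g\<in>carrier G. projection (p g)) \<and>
          orthogonal_family (carrier G) p \<and>
          (\<forall>g\<in>carrier G. \<forall>h\<in>carrier G. norm (\<alpha> g (p h) - p (g \<otimes>\<^bsub>G\<^esub> h)) < \<epsilon>) \<and>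
          (\<forall>g\<in>carrier G. \<forall>a\<in>F. norm (p g * a - a * p g) < \<epsilon>) \<and>
          (\<Sum>g\<in>carrier G. p g) = 1))"

definition rokhlin_property ::
    "('g, 'm) monoid_scheme \<Rightarrow> ('g \<Rightarrow> 'a::unital_cstar_algebra \<Rightarrow> 'a) \<Rightarrow> bool" where
  "rokhlin_property G \<alpha> \<longleftrightarrow>
     (\<forall>\<epsilon>::real. \<forall>F :: 'a set. \<epsilon> > 0 \<longrightarrow> finite F \<longrightarrow>
       (\<exists>r :: 'g \<Rightarrow> 'a.
          (\<forall>g\<in>carrier G. positive_contraction (r g)) \<and>
          orthogonal_family (carrier G) r \<and>
          (\<forall>g\<in>carrier G. \<forall>h\<in>carrier G. norm (\<alpha> g (r h) - r (g \<otimes>\<^bsub>G\<^esub> h)) < \<epsilon>) \<and>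
          (\<forall>g\<in>carrier G. \<forall>a\<in>F. norm (r g * a - a * r g) < \<epsilon>) \<and>
          (\<forall>a\<in>F. norm ((\<Sum>g\<in>carrier G. r g) * a - a) < \<epsilon>)))"

end

theory Submission
  imports Defs "HOL-Analysis.Elementary_Metric_Spaces"
begin

text \<open>
  For the nontrivial direction, let \<open>s\<close> be the sum of the orthogonal contractions \<open>r\<^sub>g\<close>.
  Testing (iii) on \<open>1\<close> makes \<open>s\<close> close to \<open>1\<close>, hence invertible. By orthogonality every \<open>r\<^sub>g\<close>
  commutes with \<open>s\<close>, so the elements \<open>p\<^sub>g = r\<^sub>g s\<inverse>\<close> are self-adjoint, mutually orthogonal
  and sum to \<open>1\<close>; therefore \<open>p\<^sub>g = p\<^sub>g \<Sum>\<^sub>h p\<^sub>h = p\<^sub>g\<^sup>2\<close> and no functional calculus is needed.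
  They are close to \<open>r\<^sub>g\<close> since \<open>r\<^sub>g - p\<^sub>g = p\<^sub>g (s - 1)\<close>.
  That automorphisms are isometric is not needed either: \<open>\<alpha>\<^sub>g(r\<^sub>h - p\<^sub>h) = \<alpha>\<^sub>g(p\<^sub>h) (\<alpha>\<^sub>g(s) - 1)\<close>,
  where \<open>\<alpha>\<^sub>g(p\<^sub>h)\<close> is a projection and \<open>\<alpha>\<^sub>g(s)\<close> is close to \<open>s\<close> by (i).
\<close>

section \<open>Scalars, adjoints and the spectrum of a projection\<close>

lemma scaleC_minus_left: "(- c) *\<^sub>C x = - (c *\<^sub>C (x::'a::unital_cstar_algebra))"
proof -
  have "0 *\<^sub>C x = 0"
    using scaleR_eq_scaleC[of 0 x] by simp
  then show ?thesis
    using scaleC_add_left[of c "- c" x] by (simp add: eq_neg_iff_add_eq_0 add.commute)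
qed

lemma star_0: "star (0::'a::unital_cstar_algebra) = 0"
  using star_add[of "0::'a" 0] by simp

lemma star_1: "star (1::'a::unital_cstar_algebra) = 1"
  by (metis mult_1_left mult_1_right star_mult star_star)

lemma star_sum: "star (\<Sum>i\<in>I. f i) = (\<Sum>i\<in>I. star (f i :: 'a::unital_cstar_algebra))"
  by (induction I rule: infinite_finite_induct) (simp_all add: star_0 star_add)

text \<open>Since \<open>star p * p = p\<close>, the C*-identity reads
  \<open>norm p = (norm p)\<^sup>2\<close>, which leaves only the values 0 and 1.\<close>

lemma norm_projection_le_1:
  fixes p :: "'a::unital_cstar_algebra"
  assumes "projection p"
  shows "norm p \<le> 1"
proof -
  have "norm p * norm p = norm p * 1"
    using assms cstar_identity[of p] by (simp add: projection_def power2_eq_square)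
  then show ?thesis
    by (metis mult_left_cancel order_refl zero_le_one)
qed

lemma spectrum_projection:
  fixes p :: "'a::unital_cstar_algebra"
  assumes "projection p"
  shows "spectrum p \<subseteq> {0, 1}"
proof
  fix c assume c: "c \<in> spectrum p"
  show "c \<in> {0, 1}"
  proof (rule ccontr)
    assume "c \<notin> {0, 1}"
    then have "c \<noteq> 0" "1 - c \<noteq> 0" by auto
    \<comment> \<open>The candidate inverse of \<open>p - c *\<^sub>C 1\<close> is p / (1 - c) - (1
      - p) / c: on the range of \<open>p\<close> the element acts as 1 - c, on the complement as -c.
      Collecting terms gives the coefficient \<open>x\<close> of \<open>p\<close> and
      \<open>y\<close> of \<open>1\<close>.\<close>
    define x where "x = 1 / (c * (1 - c))"
    define y where "y = - 1 / c"
    have y: "- c * y = 1" using \<open>c \<noteq> 0\<close> by (simp add: y_def)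
    have "x - c * x = x * (1 - c)" by (simp add: algebra_simps)
    also have "\<dots> = 1 / c" using \<open>1 - c \<noteq> 0\<close> \<open>c \<noteq> 0\<close> by (simp add: x_def)
    finally have x: "x + y + (- c * x) = 0" by (simp add: y_def algebra_simps)
    have pp: "p * p = p" using assms by (simp add: projection_def)
    have shift: "p - c *\<^sub>C 1 = p + (- c) *\<^sub>C 1"
      by (simp add: scaleC_minus_left)
    have 0: "0 *\<^sub>C p = 0"
      using scaleR_eq_scaleC[of 0 p] by simp
    \<comment> \<open>Both products below expand to this left-hand side, in which the coefficients
      of \<open>p\<close> cancel and that of \<open>1\<close> is 1.\<close>
    have eq: "x *\<^sub>C p + y *\<^sub>C p + (- c * x) *\<^sub>C p + (- c * y) *\<^sub>C 1 = 1"
      unfolding scaleC_add_left[symmetric] x y by (simp add: 0 scaleC_one)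
    have "(p - c *\<^sub>C 1) * (x *\<^sub>C p + y *\<^sub>C 1) = x *\<^sub>C p + y *\<^sub>C p + (- c * x) *\<^sub>C p + (- c * y) *\<^sub>C 1"
      unfolding shift
      by (simp add: distrib_left distrib_right mult_scaleC_left mult_scaleC_right
          scaleC_scaleC scaleC_add_right pp mult.commute add_ac)
    moreover have "(x *\<^sub>C p + y *\<^sub>C 1) * (p - c *\<^sub>C 1) = x *\<^sub>C p + y *\<^sub>C p + (- c * x) *\<^sub>C p + (- c * y) *\<^sub>C 1"
      unfolding shift
      by (simp add: distrib_left distrib_right mult_scaleC_left mult_scaleC_right
          scaleC_scaleC scaleC_add_right pp mult.commute add_ac)
    ultimately show False
      using c eq unfolding spectrum_def by auto
  qed
qed

lemma positive_contraction_projection: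
  fixes p :: "'a::unital_cstar_algebra"
  assumes "projection p"
  shows "positive_contraction p"
proof -
  have "{0, 1} \<subseteq> {complex_of_real t |t. 0 \<le> t}"
    by (auto intro: exI[of _ "0::real"] exI[of _ "1::real"])
  then show ?thesis
    using assms spectrum_projection[OF assms] norm_projection_le_1[OF assms]
    by (auto simp: positive_contraction_def positive_def projection_def)
qed

section \<open>Inverses near the unit, and correcting an almost partition to projections\<close>

lemma right_inverse_near_one:
  fixes s :: "'a::unital_cstar_algebra"
  assumes "norm (s - 1) < 1"
  shows "\<exists>t. s * t = 1"
proof -
  \<comment> \<open>The equation \<open>s * t = 1\<close> says that \<open>t\<close> is a fixed
    point of t \<mapsto> 1 - (s - 1) t. This map contracts by the factor
    \<open>norm (s - 1) < 1\<close>, so completeness provides one, in place of a Neumann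
    series.\<close>
  have "dist (1 - (s - 1) * t) (1 - (s - 1) * u) \<le> norm (s - 1) * dist t u" for t u
  proof -
    have "1 - (s - 1) * t - (1 - (s - 1) * u) = - ((s - 1) * (t - u))"
      by (simp add: algebra_simps)
    then show ?thesis
      by (simp add: dist_norm norm_mult_ineq)
  qed
  then have "\<exists>!t. 1 - (s - 1) * t = t"
    by (intro banach_fix_type[OF norm_ge_zero assms]) blast
  then obtain t where "1 - (s - 1) * t = t" by blast
  then have "s * t = 1" by (simp add: algebra_simps)
  then show ?thesis ..
qed

text \<open>For self-adjoint \<open>s\<close>, the adjoint of a right inverse is a left inverse. A
  left and a right inverse coincide, so \<open>t\<close> is two-sided and self-adjoint at
  once.\<close>

lemma inverse_near_one:
  fixes s :: "'a::unital_cstar_algebra"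
  assumes "norm (s - 1) < 1" and "star s = s"
  shows "\<exists>t. s * t = 1 \<and> t * s = 1 \<and> star t = t"
proof -
  obtain t where t: "s * t = 1"
    using right_inverse_near_one[OF assms(1)] by blast
  have t': "star t * s = 1"
    using star_mult[of s t] unfolding t star_1 assms(2) by (rule sym)
  have "star t = t"
    using t t' by (metis mult.assoc mult_1_left mult_1_right)
  then show ?thesis using t t' by auto
qed

text \<open>The last conclusion is an identity rather than an estimate: it can be transported by an
  automorphism, so it controls both \<open>r i - p i\<close> and the image of this
  difference.\<close>

lemma projections_of_almost_partition:
  fixes r :: "'i \<Rightarrow> 'a::unital_cstar_algebra"
  assumes fin: "finite I"
    and sa: "\<And>i. i \<in> I \<Longrightarrow> star (r i) = r i"
    and orth: "orthogonal_family I r"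
    and near: "norm ((\<Sum>i\<in>I. r i) - 1) < 1"
  obtains p where "\<And>i. i \<in> I \<Longrightarrow> projection (p i)" "orthogonal_family I p" "(\<Sum>i\<in>I. p i) = 1"
    "\<And>i. i \<in> I \<Longrightarrow> r i = p i * (\<Sum>j\<in>I. r j)"
proof -
  define s where "s = (\<Sum>i\<in>I. r i)"
  have "star s = s"
    by (simp add: s_def star_sum sa)
  then obtain t where t: "s * t = 1" "t * s = 1" "star t = t"
    using inverse_near_one near unfolding s_def by blast
  define p where "p i = r i * t" for i
  have comm: "t * r i = r i * t" if i: "i \<in> I" for i
  proof -
    have 0: "r i * r j = 0 \<and> r j * r i = 0" if "j \<in> I - {i}" for j
      using orth i that by (auto simp: orthogonal_family_def)
    \<comment> \<open>Orthogonality reduces both sides to \<open>r i * r i\<close>. Multiplying by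
      \<open>t\<close> on both sides then moves \<open>r i\<close> past \<open>t\<close>.\<close>
    have "r i * s = s * r i"
      by (simp add: s_def sum.remove[OF fin i] distrib_left distrib_right
          sum_distrib_left sum_distrib_right 0)
    then show ?thesis
      by (metis t(1,2) mult.assoc mult_1_left mult_1_right)
  qed
  have orth': "p i * p j = 0" if "i \<in> I" "j \<in> I" "i \<noteq> j" for i j
  proof -
    have "p i * p j = (r i * r j) * (t * t)"
      unfolding p_def by (metis comm mult.assoc that(2))
    then show ?thesis
      using orth that by (simp add: orthogonal_family_def)
  qed
  have sum: "(\<Sum>i\<in>I. p i) = 1"
    unfolding p_def sum_distrib_right[symmetric] s_def[symmetric] by (rule t(1))
  have proj: "projection (p i)" if i: "i \<in> I" for i
  proof -
    have "p i = p i * (\<Sum>j\<in>I. p j)"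
      by (simp add: sum)
    also have "\<dots> = p i * p i + (\<Sum>j\<in>I - {i}. p i * p j)"
      by (simp add: sum.remove[OF fin i] sum_distrib_left distrib_left)
    also have "(\<Sum>j\<in>I - {i}. p i * p j) = 0"
      by (rule sum.neutral) (use i orth' in auto)
    finally show ?thesis
      by (simp add: projection_def p_def star_mult sa[OF i] t(3) comm[OF i])
  qed
  show ?thesis
  proof (rule that[OF proj _ sum])
    show "orthogonal_family I p"
      using orth' by (simp add: orthogonal_family_def)
    show "r i = p i * (\<Sum>j\<in>I. r j)" for i
      by (simp add: p_def s_def[symmetric] mult.assoc t(2))
  qed
qed

section \<open>Images under automorphisms\<close>

lemma star_automorphism_sum:
  assumes "star_automorphism f"
  shows "f (\<Sum>i\<in>I. x i) = (\<Sum>i\<in>I. f (x i))"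
proof -
  have add: "f (x + y) = f x + f y" for x y
    using assms by (simp add: star_automorphism_def)
  have "f 0 = 0" using add[of 0 0] by simp
  then show ?thesis
    by (induction I rule: infinite_finite_induct) (simp_all add: add)
qed

lemma star_automorphism_projection:
  assumes "star_automorphism f" "projection p"
  shows "projection (f p)"
proof -
  have "f (star p) = star (f p)" "f (p * p) = f p * f p"
    using assms(1) by (simp_all only: star_automorphism_def)
  then show ?thesis
    using assms(2) by (simp add: projection_def)
qed

section \<open>The two implications\<close>

lemma rokhlin_property_if_unital:
  fixes \<alpha> :: "'g \<Rightarrow> 'a::unital_cstar_algebra \<Rightarrow> 'a"
  assumes "unital_rokhlin_property G \<alpha>"
  shows "rokhlin_property G \<alpha>"
  unfolding rokhlin_property_def
proof (intro allI impI)
  fix \<epsilon> :: real and F :: "'a set"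
  assume \<epsilon>: "\<epsilon> > 0" and F: "finite F"
  obtain p where p: "\<forall>g\<in>carrier G. projection (p g)" "orthogonal_family (carrier G) p"
    "\<forall>g\<in>carrier G. \<forall>h\<in>carrier G. norm (\<alpha> g (p h) - p (g \<otimes>\<^bsub>G\<^esub> h)) < \<epsilon>"
    "\<forall>g\<in>carrier G. \<forall>a\<in>F. norm (p g * a - a * p g) < \<epsilon>"
    "(\<Sum>g\<in>carrier G. p g) = 1"
    using assms[unfolded unital_rokhlin_property_def, THEN spec[of _ F], THEN spec[of _ \<epsilon>],
        THEN mp, THEN mp, OF F \<epsilon>]
    by blast
  show "\<exists>r. (\<forall>g\<in>carrier G. positive_contraction (r g)) \<and>
          orthogonal_family (carrier G) r \<and>
          (\<forall>g\<in>carrier G. \<forall>h\<in>carrier G. norm (\<alpha> g (r h) - r (g \<otimes>\<^bsub>G\<^esub> h)) < \<epsilon>) \<and>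
          (\<forall>g\<in>carrier G. \<forall>a\<in>F. norm (r g * a - a * r g) < \<epsilon>) \<and>
          (\<forall>a\<in>F. norm ((\<Sum>g\<in>carrier G. r g) * a - a) < \<epsilon>)"
  \<comment> \<open>The same family works: projections are positive contractions, and a sum equal to
    1 makes the error in the last condition zero.\<close>
  proof (intro exI[of _ p] conjI p(2-4) ballI)
    show "positive_contraction (p g)" if "g \<in> carrier G" for g
      using p(1) that positive_contraction_projection by blast
    show "norm ((\<Sum>g\<in>carrier G. p g) * a - a) < \<epsilon>" for a
      unfolding p(5) using \<epsilon> by simp
  qed
qed

lemma unital_rokhlin_property_if:
  fixes G :: "('g, 'm) monoid_scheme"
    and \<alpha> :: "'g \<Rightarrow> 'a::unital_cstar_algebra \<Rightarrow> 'a"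
  assumes "group G"
    and fin: "finite (carrier G)"
    and aut: "\<And>g. g \<in> carrier G \<Longrightarrow> star_automorphism (\<alpha> g)"
    and rokhlin: "rokhlin_property G \<alpha>"
  shows "unital_rokhlin_property G \<alpha>"
  unfolding unital_rokhlin_property_def
proof (intro allI impI)
  fix \<epsilon> :: real and F :: "'a set"
  assume F: "finite F" and \<epsilon>: "\<epsilon> > 0"
  interpret group G by fact
  define n where "n = real (card (carrier G))"
  \<comment> \<open>A common bound for the norms of the elements of \<open>F\<close>; a sum is also
    meaningful for empty \<open>F\<close>.\<close>
  define K where "K = (\<Sum>a\<in>F. norm a)"
  \<comment> \<open>Equivariance of \<open>p\<close> will cost (n + 3) \<delta> and the commutators
    (1 + 2 K) \<delta>. The summand \<epsilon> forces \<delta> < 1, hence invertibility of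
    \<open>s\<close>; the factor 2 in \<delta> keeps the total strictly below \<epsilon>.\<close>
  define N where "N = n + 3 + 2 * K + \<epsilon>"
  define \<delta> where "\<delta> = \<epsilon> / (2 * N)"
  have "n \<ge> 0" by (simp add: n_def)
  have "K \<ge> 0" by (simp add: K_def sum_nonneg)
  have "N > 0" using \<open>n \<ge> 0\<close> \<open>K \<ge> 0\<close> \<epsilon> by (simp add: N_def)
  have "\<delta> > 0" using \<epsilon> \<open>N > 0\<close> by (simp add: \<delta>_def)
  have "\<delta> * N < \<epsilon>" using \<epsilon> \<open>N > 0\<close> by (simp add: \<delta>_def)
  then have sum_lt: "\<delta> * n + \<delta> * 3 + \<delta> * (2 * K) + \<delta> * \<epsilon> < \<epsilon>"
    by (simp add: N_def distrib_left)
  have nonneg: "\<delta> * n \<ge> 0" "\<delta> * (2 * K) \<ge> 0" "\<delta> * \<epsilon> > 0"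
    using \<open>\<delta> > 0\<close> \<open>n \<ge> 0\<close> \<open>K \<ge> 0\<close> \<epsilon> by simp_all
  have "\<delta> * \<epsilon> < 1 * \<epsilon>"
    using sum_lt nonneg \<open>\<delta> > 0\<close> by linarith
  then have "\<delta> < 1" using \<epsilon> by (simp only: mult_less_cancel_right_pos)
  obtain r where r: "\<And>g. g \<in> carrier G \<Longrightarrow> positive_contraction (r g)"
    and orth: "orthogonal_family (carrier G) r"
    and equiv: "\<And>g h. g \<in> carrier G \<Longrightarrow> h \<in> carrier G \<Longrightarrow> norm (\<alpha> g (r h) - r (g \<otimes>\<^bsub>G\<^esub> h)) < \<delta>"
    and comm: "\<And>g a. g \<in> carrier G \<Longrightarrow> a \<in> F \<Longrightarrow> norm (r g * a - a * r g) < \<delta>"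
    and unit: "norm ((\<Sum>g\<in>carrier G. r g) * 1 - 1) < \<delta>"
    using rokhlin[unfolded rokhlin_property_def, THEN spec[of _ \<delta>], THEN spec[of _ "insert 1 F"],
        THEN mp, THEN mp, OF \<open>\<delta> > 0\<close> finite.insertI[OF F]]
    by blast
  define s where "s = (\<Sum>g\<in>carrier G. r g)"
  have s: "norm (s - 1) < \<delta>" using unit by (simp add: s_def)
  have "norm ((\<Sum>g\<in>carrier G. r g) - 1) < 1"
    using unit \<open>\<delta> < 1\<close> by simp
  moreover have "star (r g) = r g" if "g \<in> carrier G" for g
    using r[OF that] by (simp add: positive_contraction_def positive_def)
  ultimately obtain p where proj: "\<And>g. g \<in> carrier G \<Longrightarrow> projection (p g)"
    and porth: "orthogonal_family (carrier G) p" and psum: "(\<Sum>g\<in>carrier G. p g) = 1"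
    and rp: "\<And>g. g \<in> carrier G \<Longrightarrow> r g = p g * s"
    using projections_of_almost_partition[OF fin _ orth] unfolding s_def by blast
  have close: "norm (r g - p g) < \<delta>" if g: "g \<in> carrier G" for g
  proof -
    have "norm (r g - p g) = norm (p g * (s - 1))"
      by (simp add: rp[OF g] right_diff_distrib)
    also have "\<dots> \<le> norm (p g) * norm (s - 1)" by (rule norm_mult_ineq)
    also have "\<dots> \<le> 1 * norm (s - 1)"
      by (rule mult_right_mono[OF norm_projection_le_1[OF proj[OF g]] norm_ge_zero])
    finally show ?thesis using s by simp
  qed
  have image_close: "norm (\<alpha> g (r h) - \<alpha> g (p h)) \<le> \<delta> * n + \<delta>"
    if g: "g \<in> carrier G" and h: "h \<in> carrier G" for g h
  proof -
    \<comment> \<open>Left translation by \<open>g\<close> permutes the group, so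
      \<open>\<alpha> g s - s\<close> is a sum of \<open>n\<close> equivariance errors, each below
      \<delta>.\<close>
    have shift: "(\<Sum>k\<in>carrier G. r (g \<otimes>\<^bsub>G\<^esub> k)) = s"
      unfolding s_def
      by (rule sum.reindex_bij_witness[where i = "\<lambda>k. inv\<^bsub>G\<^esub> g \<otimes>\<^bsub>G\<^esub> k" and j = "\<lambda>k. g \<otimes>\<^bsub>G\<^esub> k"])
        (auto simp: g m_assoc[symmetric])
    have "\<alpha> g s - s = (\<Sum>k\<in>carrier G. \<alpha> g (r k) - r (g \<otimes>\<^bsub>G\<^esub> k))"
      unfolding sum_subtractf shift by (simp add: s_def star_automorphism_sum[OF aut[OF g]])
    then have "norm (\<alpha> g s - s) \<le> n * \<delta>"
      unfolding n_def by (simp only:) (intro sum_norm_bound less_imp_le equiv g)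
    moreover have "norm (\<alpha> g s - 1) \<le> norm (\<alpha> g s - s) + norm (s - 1)"
      using norm_triangle_ineq[of "\<alpha> g s - s" "s - 1"] by simp
    ultimately have s': "norm (\<alpha> g s - 1) \<le> \<delta> * n + \<delta>"
      using s by (simp add: mult.commute)
    have "\<alpha> g (r h) - \<alpha> g (p h) = \<alpha> g (p h) * (\<alpha> g s - 1)"
      using aut[OF g] by (simp add: rp[OF h] star_automorphism_def right_diff_distrib)
    then have "norm (\<alpha> g (r h) - \<alpha> g (p h)) \<le> norm (\<alpha> g (p h)) * norm (\<alpha> g s - 1)"
      by (simp add: norm_mult_ineq)
    also have "\<dots> \<le> 1 * norm (\<alpha> g s - 1)"
      by (rule mult_right_mono[OF norm_projection_le_1[OF star_automorphism_projection[OF aut[OF g] proj[OF h]]]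
            norm_ge_zero])
    finally show ?thesis using s' by simp
  qed
  have pequiv: "norm (\<alpha> g (p h) - p (g \<otimes>\<^bsub>G\<^esub> h)) < \<epsilon>"
    if g: "g \<in> carrier G" and h: "h \<in> carrier G" for g h
  proof -
    \<comment> \<open>Three errors: \<delta> for the equivariance of \<open>r\<close>, n \<delta> +
      \<delta> for replacing \<open>p\<close> by \<open>r\<close> inside \<alpha>, and \<delta> for
      replacing it outside.\<close>
    have "\<alpha> g (p h) - p (g \<otimes>\<^bsub>G\<^esub> h) = (\<alpha> g (r h) - r (g \<otimes>\<^bsub>G\<^esub> h))
        - (\<alpha> g (r h) - \<alpha> g (p h)) + (r (g \<otimes>\<^bsub>G\<^esub> h) - p (g \<otimes>\<^bsub>G\<^esub> h))" by simp
    also have "norm \<dots> \<le> norm (\<alpha> g (r h) - r (g \<otimes>\<^bsub>G\<^esub> h)) + norm (\<alpha> g (r h) - \<alpha> g (p h))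
        + norm (r (g \<otimes>\<^bsub>G\<^esub> h) - p (g \<otimes>\<^bsub>G\<^esub> h))"
      by (intro norm_triangle_le add_right_mono norm_triangle_ineq4)
    finally show ?thesis
      using equiv[OF g h] image_close[OF g h] close[OF m_closed[OF g h]] sum_lt nonneg by linarith
  qed
  have pcomm: "norm (p g * a - a * p g) < \<epsilon>" if g: "g \<in> carrier G" and a: "a \<in> F" for g a
  proof -
    have "norm a \<le> K" unfolding K_def by (rule member_le_sum) (use F a in auto)
    then have "norm (r g - p g) * norm a \<le> \<delta> * K"
      using close[OF g] \<open>\<delta> > 0\<close> by (intro mult_mono) auto
    then have bound: "norm ((r g - p g) * a) \<le> \<delta> * K" "norm (a * (r g - p g)) \<le> \<delta> * K"
      using norm_mult_ineq[of "r g - p g" a] norm_mult_ineq[of a "r g - p g"]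
      by (simp_all add: mult.commute)
    \<comment> \<open>One commutator with \<open>r g\<close> costs \<delta>, and the two
      replacements of \<open>p g\<close> by \<open>r g\<close> cost \<delta> K each.\<close>
    have "p g * a - a * p g = (r g * a - a * r g) - (r g - p g) * a + a * (r g - p g)"
      by (simp add: algebra_simps)
    also have "norm \<dots> \<le> norm (r g * a - a * r g) + norm ((r g - p g) * a) + norm (a * (r g - p g))"
      by (intro norm_triangle_le add_right_mono norm_triangle_ineq4)
    finally show ?thesis
      using comm[OF g a] bound sum_lt nonneg \<open>\<delta> > 0\<close> by linarith
  qed
  show "\<exists>p. (\<forall>g\<in>carrier G. projection (p g)) \<and>
          orthogonal_family (carrier G) p \<and>
          (\<forall>g\<in>carrier G. \<forall>h\<in>carrier G. norm (\<alpha> g (p h) - p (g \<otimes>\<^bsub>G\<^esub> h)) < \<epsilon>) \<and>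
          (\<forall>g\<in>carrier G. \<forall>a\<in>F. norm (p g * a - a * p g) < \<epsilon>) \<and>
          (\<Sum>g\<in>carrier G. p g) = 1"
    using proj porth pequiv pcomm psum by blast
qed

theorem corollary1:
  fixes G :: "('g, 'm) monoid_scheme"
    and \<alpha> :: "'g \<Rightarrow> 'a::unital_cstar_algebra \<Rightarrow> 'a"
  assumes "group G"
    and "finite (carrier G)"
    and "\<alpha> \<in> hom G Aut"
  shows "unital_rokhlin_property G \<alpha> \<longleftrightarrow> rokhlin_property G \<alpha>"
proof -
  have "star_automorphism (\<alpha> g)" if "g \<in> carrier G" for g
    using hom_in_carrier[OF assms(3) that] by (simp add: Aut_def)
  then show ?thesis
    using rokhlin_property_if_unital unital_rokhlin_property_if[OF assms(1,2)] by blast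
qed

end
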